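(* Let $\Omega\subseteq\mathbb{C}$ be a domain, $n\in\mathbb{N}$, and let $\mathcal{L}=\{\mathcal{L}(\lambda):\lambda\in\Omega\}$ be a family of operator matrices in $\mathcal{H}=\mathcal{H}_1\oplus\cdots\oplus\mathcal{H}_n$. For every $\varepsilon>0$, $$\sigma_{\mathrm{ap},\varepsilon}(\mathcal{L})\subseteq W^n_\varepsilon(\mathcal{L}),\qquad\|\mathcal{L}(\lambda)^{-1}\|\le\frac1\varepsilon,\quad\lambda\in\rho(\mathcal{L})\setminus W^n_\varepsilon(\mathcal{L}),$$ and hence $$\sigma_{\mathrm{ap}}(\mathcal{L})\subseteq W^n_\Psi(\mathcal{L});$$ if $\sigma(\mathcal{L}(\lambda))\subseteq\overline{W^n(\mathcal{L}(\lambda))}$ for all $\lambda\in\Omega$, then $$\sigma(\mathcal{L})\subseteq W^n_{\Psi,0}(\mathcal{L})\subseteq W^n_\Psi(\mathcal{L}).$$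
   Context: $\mathcal{H}_1,\dots,\mathcal{H}_n$ are nonzero complex Hilbert spaces. The family consists of densely defined operators $\mathcal{L}(\lambda)=(L_{ij}(\lambda))_{i,j=1}^n$ in $\mathcal{H}$, where each $L_{ij}(\lambda)$ is a densely defined closable linear operator from $\mathcal{H}_j$ to $\mathcal{H}_i$, with $\operatorname{dom}\mathcal{L}(\lambda)=\mathcal{D}_1(\lambda)\oplus\cdots\oplus\mathcal{D}_n(\lambda)$, $\mathcal{D}_j(\lambda)=\bigcap_{i=1}^n\operatorname{dom}L_{ij}(\lambda)$. Let $\mathcal{S}^n=\{f=(f_i)_{i=1}^n\in\mathcal{H}:\|f_i\|=1,\ i=1,\dots,n\}$ and, for $f\in\operatorname{dom}\mathcal{L}(\lambda)\cap\mathcal{S}^n$, $\mathcal{L}(\lambda)_f=\big((L_{ij}(\lambda)f_j,f_i)\big)_{i,j=1}^n\in\mathbb{C}^{n\times n}$. Block numerical range of the family: $W^n(\mathcal{L})=\{\lambda\in\Omega:\exists f\in\operatorname{dom}\mathcal{L}(\lambda)\cap\mathcal{S}^n,\ 0\in\sigma(\mathcal{L}(\lambda)_f)\}$; of a single operator matrix $\mathcal{A}$: $W^n(\mathcal{A})=\bigcup_{f\in\operatorname{dom}\mathcal{A}\cap\mathcal{S}^n}\sigma(\mathcal{A}_f)$. For $\varepsilon>0$, $W^n_\varepsilon(\mathcal{L})=\bigcup_{\mathcal{B}\in L(\mathcal{H}),\|\mathcal{B}\|<\varepsilon}W^n(\mathcal{L}+\mathcal{B})$; $W^n_\Psi(\mathcal{L})=\bigcap_{\varepsilon>0}W^n_\varepsilon(\mathcal{L})$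 (pseudo block numerical range); $W^n_{\Psi,0}(\mathcal{L})=\{\lambda\in\Omega:0\in\overline{W^n(\mathcal{L}(\lambda))}\}$. Spectra of families: $\sigma(\mathcal{L})=\{\lambda\in\Omega:0\in\sigma(\mathcal{L}(\lambda))\}$, $\rho(\mathcal{L})=\Omega\setminus\sigma(\mathcal{L})$; $\sigma_{\mathrm{ap}}(\mathcal{L})=\{\lambda\in\Omega:\exists\,(f_k)_k\subseteq\operatorname{dom}\mathcal{L}(\lambda),\|f_k\|=1,\mathcal{L}(\lambda)f_k\to0\}$; $\sigma_{\mathrm{ap},\varepsilon}(\mathcal{L})=\{\lambda\in\Omega:\exists\,f\in\operatorname{dom}\mathcal{L}(\lambda),\|f\|=1,\|\mathcal{L}(\lambda)f\|<\varepsilon\}$. *)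

theory Defs
  imports "HOL-Analysis.Analysis"
begin

text \<open>
  A complex Hilbert space is a complete normed space whose norm is induced by a complex inner
  product, linear in the first argument. The norm axioms inherited from \<^class>\<open>banach\<close> (such as
  the triangle inequality) are consequences of the inner product axioms.
\<close>

class complex_hilbert_space = banach +
  fixes scaleC :: "complex \<Rightarrow> 'a \<Rightarrow> 'a"  (infixr \<open>*\<^sub>C\<close> 75)
    and cinner :: "'a \<Rightarrow> 'a \<Rightarrow> complex"
  assumes scaleC_add_right: "c *\<^sub>C (x + y) = c *\<^sub>C x + c *\<^sub>C y"
    and scaleC_add_left: "(c + d) *\<^sub>C x = c *\<^sub>C x + d *\<^sub>C x"
    and scaleC_scaleC: "c *\<^sub>C (d *\<^sub>C x) = (c * d) *\<^sub>C x"
    and scaleC_one: "1 *\<^sub>C x = x"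
    and scaleR_scaleC: "r *\<^sub>R x = complex_of_real r *\<^sub>C x"
    and cinner_commute: "cinner x y = cnj (cinner y x)"
    and cinner_add_left: "cinner (x + y) z = cinner x z + cinner y z"
    and cinner_scaleC_left: "cinner (c *\<^sub>C x) y = c * cinner x y"
    and cinner_self: "cinner x x = complex_of_real ((norm x)\<^sup>2)"

instantiation complex :: complex_hilbert_space
begin

definition scaleC_complex :: "complex \<Rightarrow> complex \<Rightarrow> complex"
  where "scaleC_complex c x = c * x"

definition cinner_complex :: "complex \<Rightarrow> complex \<Rightarrow> complex"
  where "cinner_complex x y = x * cnj y"

instance
proof
  fix c d :: complex and r :: real and x y z :: complex
  show "c *\<^sub>C (x + y) = c *\<^sub>C x + c *\<^sub>C y" "(c + d) *\<^sub>C x = c *\<^sub>C x + d *\<^sub>C x"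
    by (simp_all add: scaleC_complex_def distrib_left distrib_right)
  show "c *\<^sub>C (d *\<^sub>C x) = (c * d) *\<^sub>C x" "1 *\<^sub>C x = x"
    by (simp_all add: scaleC_complex_def)
  show "r *\<^sub>R x = complex_of_real r *\<^sub>C x"
    unfolding scaleC_complex_def by (rule scaleR_conv_of_real)
  show "cinner x y = cnj (cinner y x)" "cinner (c *\<^sub>C x) y = c * cinner x y"
    by (simp_all add: scaleC_complex_def cinner_complex_def)
  show "cinner (x + y) z = cinner x z + cinner y z"
    by (simp add: cinner_complex_def distrib_right)
  show "cinner x x = complex_of_real ((norm x)\<^sup>2)"
    unfolding cinner_complex_def by (rule complex_norm_square [symmetric])
qed

end

instantiation vec :: (complex_hilbert_space, finite) complex_hilbert_space
begin

definition scaleC_vec :: "complex \<Rightarrow> 'a ^ 'b \<Rightarrow> 'a ^ 'b"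
  where "scaleC_vec c f = (\<chi> i. c *\<^sub>C (f $ i))"

definition cinner_vec :: "'a ^ 'b \<Rightarrow> 'a ^ 'b \<Rightarrow> complex"
  where "cinner_vec f g = (\<Sum>i\<in>UNIV. cinner (f $ i) (g $ i))"

instance
proof
  fix c d :: complex and r :: real and f g h :: "'a ^ 'b"
  show "c *\<^sub>C (f + g) = c *\<^sub>C f + c *\<^sub>C g"
    by (simp add: scaleC_vec_def vec_eq_iff scaleC_add_right)
  show "(c + d) *\<^sub>C f = c *\<^sub>C f + d *\<^sub>C f"
    by (simp add: scaleC_vec_def vec_eq_iff scaleC_add_left)
  show "c *\<^sub>C (d *\<^sub>C f) = (c * d) *\<^sub>C f"
    by (simp add: scaleC_vec_def vec_eq_iff scaleC_scaleC)
  show "1 *\<^sub>C f = f"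
    by (simp add: scaleC_vec_def vec_eq_iff scaleC_one)
  show "r *\<^sub>R f = complex_of_real r *\<^sub>C f"
    by (simp add: scaleC_vec_def vec_eq_iff scaleR_scaleC)
  show "cinner f g = cnj (cinner g f)"
    unfolding cinner_vec_def cnj_sum by (intro sum.cong refl cinner_commute)
  show "cinner (f + g) h = cinner f h + cinner g h"
    by (simp add: cinner_vec_def cinner_add_left sum.distrib)
  show "cinner (c *\<^sub>C f) g = c * cinner f g"
    by (simp add: cinner_vec_def scaleC_vec_def cinner_scaleC_left sum_distrib_left)
  show "cinner f f = complex_of_real ((norm f)\<^sup>2)"
    by (simp add: cinner_vec_def cinner_self norm_vec_def L2_set_def sum_nonneg)
qed

end

definition csubspace :: "'a::complex_hilbert_space set \<Rightarrow> bool"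
  where "csubspace S \<longleftrightarrow>
    0 \<in> S \<and> (\<forall>x\<in>S. \<forall>y\<in>S. x + y \<in> S) \<and> (\<forall>c. \<forall>x\<in>S. c *\<^sub>C x \<in> S)"

text \<open>
  The Hilbert spaces \<open>H\<^sub>1, \<dots>, H\<^sub>n\<close> are given as nonzero closed subspaces \<open>H i\<close> of one ambient Hilbert
  space type, \<open>i\<close> ranging over a finite index type; every finite family of Hilbert spaces has this
  form up to isometric isomorphism, via the embeddings into its direct sum. No relation between the
  \<open>H i\<close> inside the ambient space is assumed: \<open>direct_sum H\<close> below is the external direct sum.
\<close>

definition hilbert_family :: "('n \<Rightarrow> 'a::complex_hilbert_space set) \<Rightarrow> bool"
  where "hilbert_family H \<longleftrightarrow> (\<forall>i. csubspace (H i) \<and> closed (H i) \<and> H i \<noteq> {0})"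

definition direct_sum :: "('n \<Rightarrow> 'a set) \<Rightarrow> ('a ^ 'n) set"
  where "direct_sum D = {f. \<forall>i. f $ i \<in> D i}"

text \<open>
  A partially defined operator is a domain together with a function, of which only the values on
  the domain are relevant.
\<close>

record 'a partial_op =
  op_dom :: "'a set"
  op_app :: "'a \<Rightarrow> 'a"

definition linear_op ::
    "'a::complex_hilbert_space set \<Rightarrow> 'a set \<Rightarrow> 'a partial_op \<Rightarrow> bool"
  where "linear_op X Y T \<longleftrightarrow>
    op_dom T \<subseteq> X \<and> csubspace (op_dom T) \<and> op_app T ` op_dom T \<subseteq> Y \<and>
    (\<forall>x\<in>op_dom T. \<forall>y\<in>op_dom T. op_app T (x + y) = op_app T x + op_app T y) \<and>
    (\<forall>c. \<forall>x\<in>op_dom T. op_app T (c *\<^sub>C x) = c *\<^sub>C op_app T x)"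

definition densely_defined :: "'a::topological_space set \<Rightarrow> 'a partial_op \<Rightarrow> bool"
  where "densely_defined X T \<longleftrightarrow> X \<subseteq> closure (op_dom T)"

definition closable_op :: "'a::real_normed_vector partial_op \<Rightarrow> bool"
  where "closable_op T \<longleftrightarrow>
    (\<forall>x y. (\<forall>k. x k \<in> op_dom T) \<longrightarrow> x \<longlonglongrightarrow> 0 \<longrightarrow> (\<lambda>k. op_app T (x k)) \<longlonglongrightarrow> y \<longrightarrow> y = 0)"

definition bounded_ops :: "'a::complex_hilbert_space set \<Rightarrow> 'a partial_op set"
  where "bounded_ops X = {T. linear_op X X T \<and> op_dom T = X \<and>
    (\<exists>C. \<forall>x\<in>X. norm (op_app T x) \<le> C * norm x)}"

text \<open>Only meaningful for bounded operators, being a supremum of real numbers.\<close>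

definition op_norm :: "'a::real_normed_vector partial_op \<Rightarrow> real"
  where "op_norm T = (SUP x\<in>{x \<in> op_dom T. norm x \<le> 1}. norm (op_app T x))"

definition op_plus :: "'a::plus partial_op \<Rightarrow> 'a partial_op \<Rightarrow> 'a partial_op"
  where "op_plus S T =
    \<lparr>op_dom = op_dom S \<inter> op_dom T, op_app = (\<lambda>x. op_app S x + op_app T x)\<rparr>"

definition op_shift :: "'a::complex_hilbert_space partial_op \<Rightarrow> complex \<Rightarrow> 'a partial_op"
  where "op_shift T z = \<lparr>op_dom = op_dom T, op_app = (\<lambda>x. op_app T x - z *\<^sub>C x)\<rparr>"

definition op_inverse :: "'a partial_op \<Rightarrow> 'a partial_op"
  where "op_inverse T =
    \<lparr>op_dom = op_app T ` op_dom T, op_app = inv_into (op_dom T) (op_app T)\<rparr>"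

text \<open>
  The operators need not be closed, so boundedness of the inverse is part of the definition of
  the resolvent set.
\<close>

definition op_resolvent_set ::
    "'a::complex_hilbert_space set \<Rightarrow> 'a partial_op \<Rightarrow> complex set"
  where "op_resolvent_set X T =
    {z. inj_on (op_app (op_shift T z)) (op_dom T) \<and> op_inverse (op_shift T z) \<in> bounded_ops X}"

definition op_spectrum :: "'a::complex_hilbert_space set \<Rightarrow> 'a partial_op \<Rightarrow> complex set"
  where "op_spectrum X T = - op_resolvent_set X T"

definition matrix_spectrum :: "complex ^ 'n ^ 'n \<Rightarrow> complex set"
  where "matrix_spectrum A = {z. \<not> invertible (A - mat z)}"

text \<open>
  In an operator matrix \<open>A\<close>, the entry \<open>A i j\<close> is an operator from \<open>H j\<close> to \<open>H i\<close>.
\<close>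

type_synonym ('a, 'n) op_matrix = "'n \<Rightarrow> 'n \<Rightarrow> 'a partial_op"

definition matrix_op ::
    "('a::complex_hilbert_space, 'n::finite) op_matrix \<Rightarrow> ('a ^ 'n) partial_op"
  where "matrix_op A =
    \<lparr>op_dom = direct_sum (\<lambda>j. \<Inter>i. op_dom (A i j)),
     op_app = (\<lambda>f. \<chi> i. \<Sum>j\<in>UNIV. op_app (A i j) (f $ j))\<rparr>"

definition operator_matrix ::
    "('n \<Rightarrow> 'a set) \<Rightarrow> ('a::complex_hilbert_space, 'n::finite) op_matrix \<Rightarrow> bool"
  where "operator_matrix H A \<longleftrightarrow>
    (\<forall>i j. linear_op (H j) (H i) (A i j) \<and> densely_defined (H j) (A i j) \<and> closable_op (A i j)) \<and>
    densely_defined (direct_sum H) (matrix_op A)"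

text \<open>The block representation of an operator \<open>B\<close> on the direct sum.\<close>

definition blocks ::
    "('n \<Rightarrow> 'a set) \<Rightarrow> ('a::complex_hilbert_space ^ 'n::finite) partial_op \<Rightarrow> ('a, 'n) op_matrix"
  where "blocks H B i j = \<lparr>op_dom = H j, op_app = (\<lambda>x. op_app B (axis j x) $ i)\<rparr>"

definition op_matrix_plus ::
    "('a::plus, 'n) op_matrix \<Rightarrow> ('a, 'n) op_matrix \<Rightarrow> ('a, 'n) op_matrix"
  where "op_matrix_plus A B i j = op_plus (A i j) (B i j)"

definition unit_tuples :: "('n \<Rightarrow> 'a::complex_hilbert_space set) \<Rightarrow> ('a ^ 'n) set"
  where "unit_tuples H = {f \<in> direct_sum H. \<forall>i. norm (f $ i) = 1}"

definition compression ::
    "('a::complex_hilbert_space, 'n) op_matrix \<Rightarrow> 'a ^ 'n \<Rightarrow> complex ^ 'n ^ 'n"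
  where "compression A f = (\<chi> i j. cinner (op_app (A i j) (f $ j)) (f $ i))"

definition block_numerical_range ::
    "('n \<Rightarrow> 'a set) \<Rightarrow> ('a::complex_hilbert_space, 'n::finite) op_matrix \<Rightarrow> complex set"
  where "block_numerical_range H A =
    (\<Union>f \<in> op_dom (matrix_op A) \<inter> unit_tuples H. matrix_spectrum (compression A f))"

type_synonym ('a, 'n) op_matrix_family = "complex \<Rightarrow> ('a, 'n) op_matrix"

definition family_block_numerical_range ::
    "('n \<Rightarrow> 'a set) \<Rightarrow> complex set \<Rightarrow>
     ('a::complex_hilbert_space, 'n::finite) op_matrix_family \<Rightarrow> complex set"
  where "family_block_numerical_range H \<Omega> L =
    {z \<in> \<Omega>. \<exists>f \<in> op_dom (matrix_op (L z)) \<inter> unit_tuples H.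
      0 \<in> matrix_spectrum (compression (L z) f)}"

definition eps_block_numerical_range ::
    "('n \<Rightarrow> 'a set) \<Rightarrow> complex set \<Rightarrow> real \<Rightarrow>
     ('a::complex_hilbert_space, 'n::finite) op_matrix_family \<Rightarrow> complex set"
  where "eps_block_numerical_range H \<Omega> \<epsilon> L =
    (\<Union>B \<in> {B \<in> bounded_ops (direct_sum H). op_norm B < \<epsilon>}.
      family_block_numerical_range H \<Omega> (\<lambda>z. op_matrix_plus (L z) (blocks H B)))"

definition pseudo_block_numerical_range ::
    "('n \<Rightarrow> 'a set) \<Rightarrow> complex set \<Rightarrow>
     ('a::complex_hilbert_space, 'n::finite) op_matrix_family \<Rightarrow> complex set"
  where "pseudo_block_numerical_range H \<Omega> L =
    (\<Inter>\<epsilon> \<in> {0<..}. eps_block_numerical_range H \<Omega> \<epsilon> L)"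

definition pseudo_block_numerical_range0 ::
    "('n \<Rightarrow> 'a set) \<Rightarrow> complex set \<Rightarrow>
     ('a::complex_hilbert_space, 'n::finite) op_matrix_family \<Rightarrow> complex set"
  where "pseudo_block_numerical_range0 H \<Omega> L =
    {z \<in> \<Omega>. 0 \<in> closure (block_numerical_range H (L z))}"

definition family_spectrum ::
    "('n \<Rightarrow> 'a set) \<Rightarrow> complex set \<Rightarrow>
     ('a::complex_hilbert_space, 'n::finite) op_matrix_family \<Rightarrow> complex set"
  where "family_spectrum H \<Omega> L = {z \<in> \<Omega>. 0 \<in> op_spectrum (direct_sum H) (matrix_op (L z))}"

definition family_resolvent_set ::
    "('n \<Rightarrow> 'a set) \<Rightarrow> complex set \<Rightarrow>
     ('a::complex_hilbert_space, 'n::finite) op_matrix_family \<Rightarrow> complex set"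
  where "family_resolvent_set H \<Omega> L = \<Omega> - family_spectrum H \<Omega> L"

definition approx_point_spectrum ::
    "complex set \<Rightarrow> ('a::complex_hilbert_space, 'n::finite) op_matrix_family \<Rightarrow> complex set"
  where "approx_point_spectrum \<Omega> L =
    {z \<in> \<Omega>. \<exists>f. (\<forall>k::nat. f k \<in> op_dom (matrix_op (L z)) \<and> norm (f k) = 1) \<and>
      (\<lambda>k. op_app (matrix_op (L z)) (f k)) \<longlonglongrightarrow> 0}"

definition eps_approx_point_spectrum ::
    "complex set \<Rightarrow> real \<Rightarrow> ('a::complex_hilbert_space, 'n::finite) op_matrix_family \<Rightarrow> complex set"
  where "eps_approx_point_spectrum \<Omega> \<epsilon> L =
    {z \<in> \<Omega>. \<exists>f \<in> op_dom (matrix_op (L z)).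
      norm f = 1 \<and> norm (op_app (matrix_op (L z)) f) < \<epsilon>}"

end

theory Submission
  imports Defs
begin

text \<open>
  If \<open>\<parallel>f\<parallel> = 1\<close> and \<open>\<parallel>A f\<parallel> < \<epsilon>\<close>, the rank-one operator \<open>B = - (\<sqdot>, f) A f\<close> has norm below \<open>\<epsilon>\<close> and
  \<open>(A + B) f = 0\<close>. Normalising the components of \<open>f\<close> (and replacing zero components by arbitrary
  unit vectors of the domain) turns this into the statement that the vector \<open>(\<parallel>f\<^sub>1\<parallel>, \<dots>, \<parallel>f\<^sub>n\<parallel>)\<close> lies
  in the kernel of a compression of \<open>A + B\<close>. For the last inclusion, a point \<open>\<mu>\<close> of the block
  numerical range with \<open>\<bar>\<mu>\<bar> < \<epsilon>\<close> is moved to \<open>0\<close> by the perturbation \<open>B = - \<mu> I\<close>.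
\<close>

section \<open>Inner product calculus over the complex scalars\<close>

lemma cinner_add_right: "cinner x (y + z) = cinner x y + cinner x z"
  by (metis cinner_commute cinner_add_left complex_cnj_add)

lemma cinner_scaleC_right: "cinner x (c *\<^sub>C y) = cnj c * cinner x y"
  by (metis cinner_commute cinner_scaleC_left complex_cnj_mult)

lemma cinner_zero_left [simp]: "cinner 0 x = 0"
  using cinner_add_left[of 0 0 x] by simp

lemma scaleC_zero_right [simp]: "c *\<^sub>C 0 = 0"
  using scaleC_add_right[of c 0 0] by simp

lemma scaleC_zero_left [simp]: "0 *\<^sub>C x = 0"
  using scaleC_add_left[of 0 0 x] by simp

lemma scaleC_minus_left: "(- c) *\<^sub>C x = - (c *\<^sub>C x)"
  using scaleC_add_left[of c "- c" x] by (simp add: eq_neg_iff_add_eq_0 add.commute)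

text \<open>The inherited norm axioms give homogeneity for real scalars only. For complex ones it
  comes from comparing \<open>cinner_self\<close> at \<open>x\<close> and at its multiple.\<close>

lemma norm_scaleC: "norm (c *\<^sub>C x) = cmod c * norm x"
proof -
  have "complex_of_real ((norm (c *\<^sub>C x))\<^sup>2) = c * (cnj c * cinner x x)"
    by (simp only: cinner_self[symmetric] cinner_scaleC_left cinner_scaleC_right mult.left_commute)
  also have "\<dots> = complex_of_real ((cmod c * norm x)\<^sup>2)"
    by (simp add: cinner_self power_mult_distrib complex_norm_square[of c, symmetric] flip: of_real_power)
  finally have "(norm (c *\<^sub>C x))\<^sup>2 = (cmod c * norm x)\<^sup>2"
    by (simp only: of_real_eq_iff)
  then show ?thesis
    by simp
qed

lemma cinner_sum_left: "cinner (\<Sum>i\<in>I. x i) y = (\<Sum>i\<in>I. cinner (x i) y)"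
  by (induction I rule: infinite_finite_induct) (simp_all add: cinner_add_left)

text \<open>Cauchy-Schwarz, from the nonnegative squared norm of the component of \<open>x\<close>
  orthogonal to \<open>y\<close>. It bounds the rank-one perturbations.\<close>

lemma norm_cinner_le: "cmod (cinner x y) \<le> norm x * norm y"
proof (cases "y = 0")
  case True
  then show ?thesis
    by (metis cinner_commute cinner_zero_left complex_cnj_zero norm_zero mult_zero_right order_refl)
next
  case False
  \<comment> \<open>This choice makes \<open>x\<close> plus \<open>c\<close> times \<open>y\<close>
    orthogonal to \<open>y\<close>.\<close>
  define c where "c = - cinner x y / complex_of_real ((norm y)\<^sup>2)"
  have c: "c * complex_of_real ((norm y)\<^sup>2) = - cinner x y"
    using False by (simp add: c_def)
  have "complex_of_real ((norm (x + c *\<^sub>C y))\<^sup>2)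
      = cinner x x + cnj c * cinner x y + c * cinner y x + cnj c * (c * cinner y y)"
    unfolding cinner_self[symmetric]
    by (simp add: cinner_add_left cinner_add_right cinner_scaleC_left cinner_scaleC_right
        algebra_simps)
  \<comment> \<open>By the choice of \<open>c\<close>, the terms with the factor
    \<open>cnj c\<close> cancel.\<close>
  also have "\<dots> = cinner x x + c * cnj (cinner x y)"
    using c by (simp add: cinner_self cinner_commute[of y x])
  finally have "complex_of_real ((norm (x + c *\<^sub>C y))\<^sup>2)
      = complex_of_real ((norm x)\<^sup>2) + c * cnj (cinner x y)"
    by (simp only: cinner_self)
  \<comment> \<open>Multiplying by the squared norm of \<open>y\<close> clears the denominator of
    \<open>c\<close>.\<close>
  then have "complex_of_real ((norm (x + c *\<^sub>C y))\<^sup>2 * (norm y)\<^sup>2)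
      = complex_of_real ((norm x)\<^sup>2 * (norm y)\<^sup>2)
        + (c * complex_of_real ((norm y)\<^sup>2)) * cnj (cinner x y)"
    by (simp add: algebra_simps)
  also have "\<dots> = complex_of_real ((norm x)\<^sup>2 * (norm y)\<^sup>2 - (cmod (cinner x y))\<^sup>2)"
    unfolding c by (simp add: complex_norm_square[symmetric] flip: of_real_power)
  finally have "(norm x)\<^sup>2 * (norm y)\<^sup>2 - (cmod (cinner x y))\<^sup>2
      = (norm (x + c *\<^sub>C y))\<^sup>2 * (norm y)\<^sup>2"
    by (simp only: of_real_eq_iff)
  moreover have "0 \<le> (norm (x + c *\<^sub>C y))\<^sup>2 * (norm y)\<^sup>2"
    by simp
  ultimately have "(cmod (cinner x y))\<^sup>2 \<le> (norm x * norm y)\<^sup>2"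
    unfolding power_mult_distrib by linarith
  then show ?thesis
    by (simp add: power2_le_iff_abs_le)
qed

section \<open>Complex subspaces and linear operators with a domain\<close>

lemma csubspace_0: "csubspace S \<Longrightarrow> 0 \<in> S"
  and csubspace_add: "csubspace S \<Longrightarrow> x \<in> S \<Longrightarrow> y \<in> S \<Longrightarrow> x + y \<in> S"
  and csubspace_scaleC: "csubspace S \<Longrightarrow> x \<in> S \<Longrightarrow> c *\<^sub>C x \<in> S"
  by (auto simp: csubspace_def)

lemma csubspace_sum: "csubspace S \<Longrightarrow> (\<And>i. i \<in> I \<Longrightarrow> x i \<in> S) \<Longrightarrow> (\<Sum>i\<in>I. x i) \<in> S"
  by (induction I rule: infinite_finite_induct) (auto intro: csubspace_0 csubspace_add)

lemma csubspace_Inter: "(\<And>i. i \<in> I \<Longrightarrow> csubspace (S i)) \<Longrightarrow> csubspace (\<Inter>i\<in>I. S i)"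
  by (auto simp: csubspace_def)

lemma csubspace_direct_sum:
  fixes D :: "'n::finite \<Rightarrow> 'a::complex_hilbert_space set"
  shows "(\<And>i. csubspace (D i)) \<Longrightarrow> csubspace (direct_sum D)"
  by (auto simp: csubspace_def direct_sum_def scaleC_vec_def)

lemma linear_op_add:
  "linear_op X Y T \<Longrightarrow> x \<in> op_dom T \<Longrightarrow> y \<in> op_dom T \<Longrightarrow> op_app T (x + y) = op_app T x + op_app T y"
  and linear_op_scaleC:
  "linear_op X Y T \<Longrightarrow> x \<in> op_dom T \<Longrightarrow> op_app T (c *\<^sub>C x) = c *\<^sub>C op_app T x"
  and linear_op_csubspace: "linear_op X Y T \<Longrightarrow> csubspace (op_dom T)"
  and linear_op_dom: "linear_op X Y T \<Longrightarrow> op_dom T \<subseteq> X"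
  and linear_op_range: "linear_op X Y T \<Longrightarrow> x \<in> op_dom T \<Longrightarrow> op_app T x \<in> Y"
  by (auto simp: linear_op_def)

lemma linear_op_0: "linear_op X Y T \<Longrightarrow> op_app T 0 = 0"
  using linear_op_scaleC[of X Y T 0 0] by (simp add: csubspace_0 linear_op_csubspace)

lemma linear_op_sum:
  assumes T: "linear_op X Y T" and x: "\<And>i. i \<in> I \<Longrightarrow> x i \<in> op_dom T"
  shows "op_app T (\<Sum>i\<in>I. x i) = (\<Sum>i\<in>I. op_app T (x i))"
  using x
  by (induction I rule: infinite_finite_induct)
    (simp_all add: linear_op_0[OF T] linear_op_add[OF T] csubspace_sum[OF linear_op_csubspace[OF T]])

section \<open>Upper bounds for operator norms and the two types of perturbation\<close>

lemma op_norm_le: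
  fixes T :: "'a::real_normed_vector partial_op"
  assumes "0 \<in> op_dom T" and "0 \<le> C" and "\<And>x. x \<in> op_dom T \<Longrightarrow> norm (op_app T x) \<le> C * norm x"
  shows "op_norm T \<le> C"
  unfolding op_norm_def
proof (rule cSUP_least)
  \<comment> \<open>A supremum of reals is controlled by an upper bound only over a nonempty set;
    the zero vector provides an element.\<close>
  show "{x \<in> op_dom T. norm x \<le> 1} \<noteq> {}"
    using assms(1) by force
  show "norm (op_app T x) \<le> C" if "x \<in> {x \<in> op_dom T. norm x \<le> 1}" for x
    using assms(3)[of x] mult_left_mono[of "norm x" 1 C] assms(2) that by simp
qed

lemma rank_one_bounded_op:
  fixes X :: "'a::complex_hilbert_space set" and v w :: 'a
  assumes "csubspace X" and "w \<in> X"
  defines "B \<equiv> \<lparr>op_dom = X, op_app = (\<lambda>x. cinner x v *\<^sub>C w)\<rparr>"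
  shows "B \<in> bounded_ops X" and "op_norm B \<le> norm v * norm w"
proof -
  have le: "norm (op_app B x) \<le> (norm v * norm w) * norm x" for x
    using mult_right_mono[OF norm_cinner_le[of x v] norm_ge_zero[of w]]
    by (simp add: B_def norm_scaleC mult_ac)
  show "B \<in> bounded_ops X"
    unfolding bounded_ops_def
  proof (intro CollectI conjI exI ballI)
    show "linear_op X X B"
      using assms(1,2) csubspace_scaleC[OF assms(1)] by (simp add: linear_op_def B_def image_subset_iff
          cinner_add_left scaleC_add_left cinner_scaleC_left scaleC_scaleC)
    show "op_dom B = X"
      by (simp add: B_def)
  qed (rule le)
  show "op_norm B \<le> norm v * norm w"
    using assms(1) le by (intro op_norm_le) (auto simp: B_def csubspace_0)
qed

text \<open>An inequality is all that holds for general \<open>X\<close>: on the zero space the norm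
  is 0 for every \<open>c\<close>.\<close>

lemma scalar_bounded_op:
  fixes X :: "'a::complex_hilbert_space set" and c :: complex
  assumes "csubspace X"
  defines "B \<equiv> \<lparr>op_dom = X, op_app = (\<lambda>x. c *\<^sub>C x)\<rparr>"
  shows "B \<in> bounded_ops X" and "op_norm B \<le> cmod c"
proof -
  have le: "norm (op_app B x) \<le> cmod c * norm x" for x
    by (simp add: B_def norm_scaleC)
  show "B \<in> bounded_ops X"
    unfolding bounded_ops_def
  proof (intro CollectI conjI exI ballI)
    show "linear_op X X B"
      using assms(1) csubspace_scaleC[OF assms(1)] by (simp add: linear_op_def B_def image_subset_iff
          scaleC_add_right scaleC_scaleC mult.commute)
    show "op_dom B = X"
      by (simp add: B_def)
  qed (rule le)
  show "op_norm B \<le> cmod c"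
    using assms(1) le by (intro op_norm_le) (auto simp: B_def csubspace_0)
qed

section \<open>Operator matrices and their bounded perturbations\<close>

lemma matrix_op_dom: "op_dom (matrix_op A) = direct_sum (\<lambda>j. \<Inter>i. op_dom (A i j))"
  and matrix_op_app: "op_app (matrix_op A) f $ i = (\<Sum>j\<in>UNIV. op_app (A i j) (f $ j))"
  by (simp_all add: matrix_op_def)

context
  fixes H :: "'n::finite \<Rightarrow> 'a::complex_hilbert_space set"
    and A :: "('a, 'n) op_matrix"
  assumes H: "hilbert_family H" and A: "operator_matrix H A"
begin

lemma hilbert_family_csubspace: "csubspace (H i)"
  using H by (simp add: hilbert_family_def)

lemma csubspace_hilbert_direct_sum: "csubspace (direct_sum H)"
  by (rule csubspace_direct_sum) (rule hilbert_family_csubspace)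

lemma operator_matrix_linear_op: "linear_op (H j) (H i) (A i j)"
  using A by (simp add: operator_matrix_def)

lemma csubspace_column_dom: "csubspace (\<Inter>i. op_dom (A i j))"
  by (rule csubspace_Inter) (rule linear_op_csubspace[OF operator_matrix_linear_op])

lemma linear_op_matrix_op: "linear_op (direct_sum H) (direct_sum H) (matrix_op A)"
  unfolding linear_op_def
proof (intro conjI ballI allI)
  show "op_dom (matrix_op A) \<subseteq> direct_sum H"
    unfolding matrix_op_dom direct_sum_def
    using linear_op_dom[OF operator_matrix_linear_op] by blast
  show "csubspace (op_dom (matrix_op A))"
    unfolding matrix_op_dom by (rule csubspace_direct_sum) (rule csubspace_column_dom)
  show "op_app (matrix_op A) ` op_dom (matrix_op A) \<subseteq> direct_sum H"
    unfolding matrix_op_dom direct_sum_def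
    by (auto simp: matrix_op_app intro!: csubspace_sum hilbert_family_csubspace
        linear_op_range[OF operator_matrix_linear_op])
next
  fix f g assume "f \<in> op_dom (matrix_op A)" "g \<in> op_dom (matrix_op A)"
  then show "op_app (matrix_op A) (f + g) = op_app (matrix_op A) f + op_app (matrix_op A) g"
    by (simp add: vec_eq_iff matrix_op_app matrix_op_dom direct_sum_def sum.distrib
        linear_op_add[OF operator_matrix_linear_op])
next
  fix c f assume f: "f \<in> op_dom (matrix_op A)"
  have "(\<Sum>j\<in>J. c *\<^sub>C y j) = c *\<^sub>C (\<Sum>j\<in>J. y j)" for y :: "'n \<Rightarrow> 'a" and J
    by (induction J rule: infinite_finite_induct) (simp_all add: scaleC_add_right)
  then show "op_app (matrix_op A) (c *\<^sub>C f) = c *\<^sub>C op_app (matrix_op A) f"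
    using f by (simp add: vec_eq_iff matrix_op_app matrix_op_dom direct_sum_def scaleC_vec_def
        linear_op_scaleC[OF operator_matrix_linear_op])
qed

text \<open>Density of the matrix domain and nontriviality of \<open>H j\<close> together force a
  nonzero vector into each column domain. These vectors later replace zero components.\<close>

lemma column_dom_unit_vector: "\<exists>x \<in> (\<Inter>i. op_dom (A i j)). norm x = 1"
proof -
  obtain x where x: "x \<in> H j" "x \<noteq> 0"
    using H csubspace_0[OF hilbert_family_csubspace[of j]] unfolding hilbert_family_def by blast
  have "axis j x \<in> direct_sum H"
    using x by (auto simp: direct_sum_def axis_def csubspace_0[OF hilbert_family_csubspace])
  then have "axis j x \<in> closure (op_dom (matrix_op A))"
    using A by (auto simp: operator_matrix_def densely_defined_def)
  then obtain d where d: "d \<in> op_dom (matrix_op A)" "dist d (axis j x) < norm x"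
    using x by (meson closure_approachable zero_less_norm_iff)
  have "norm (d $ j - x) < norm x"
    using d(2) Finite_Cartesian_Product.norm_nth_le[of "d - axis j x" j]
    by (simp add: dist_norm axis_def)
  then have nz: "d $ j \<noteq> 0"
    by auto
  have "d $ j \<in> (\<Inter>i. op_dom (A i j))"
    using d(1) by (simp add: matrix_op_dom direct_sum_def)
  then have "complex_of_real (1 / norm (d $ j)) *\<^sub>C (d $ j) \<in> (\<Inter>i. op_dom (A i j))"
    by (rule csubspace_scaleC[OF csubspace_column_dom])
  moreover have "norm (complex_of_real (1 / norm (d $ j)) *\<^sub>C (d $ j)) = 1"
    using nz by (simp add: norm_scaleC norm_divide)
  ultimately show ?thesis
    by blast
qed

text \<open>Every block of \<open>B\<close> has the full space \<open>H j\<close> as its domain, so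
  intersecting with it removes nothing.\<close>

lemma dom_perturbed:
  "op_dom (matrix_op (op_matrix_plus A (blocks H B))) = op_dom (matrix_op A)"
proof -
  have "op_dom (A i j) \<inter> H j = op_dom (A i j)" for i j
    using linear_op_dom[OF operator_matrix_linear_op] by blast
  then show ?thesis
    by (simp add: matrix_op_dom op_matrix_plus_def op_plus_def blocks_def)
qed

text \<open>Decomposing \<open>f\<close> into its axis vectors and using linearity of
  \<open>B\<close>, the blocks reassemble to \<open>B\<close> itself.\<close>

lemma app_perturbed:
  assumes B: "B \<in> bounded_ops (direct_sum H)" and f: "f \<in> op_dom (matrix_op A)"
  shows "op_app (matrix_op (op_matrix_plus A (blocks H B))) f
    = op_app (matrix_op A) f + op_app B f"
proof -
  have lin: "linear_op (direct_sum H) (direct_sum H) B" and dom: "op_dom B = direct_sum H"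
    using B by (auto simp: bounded_ops_def)
  have "f \<in> direct_sum H"
    using f linear_op_dom[OF linear_op_matrix_op] by blast
  then have "axis j (f $ j) \<in> op_dom B" for j
    unfolding dom by (auto simp: direct_sum_def axis_def csubspace_0[OF hilbert_family_csubspace])
  then have "op_app B (\<Sum>j\<in>UNIV. axis j (f $ j)) = (\<Sum>j\<in>UNIV. op_app B (axis j (f $ j)))"
    by (intro linear_op_sum[OF lin])
  moreover have "(\<Sum>j\<in>UNIV. axis j (f $ j)) = f"
    by (simp add: vec_eq_iff axis_def)
  ultimately show ?thesis
    by (simp add: vec_eq_iff matrix_op_app op_matrix_plus_def op_plus_def blocks_def sum.distrib)
qed

section \<open>Perturbations with a singular compression\<close>

lemma operator_matrix_perturbed_linear:
  assumes "B \<in> bounded_ops (direct_sum H)"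
    and "x \<in> (\<Inter>i. op_dom (A i j))"
  shows "op_app (op_matrix_plus A (blocks H B) i j) (c *\<^sub>C x)
    = c *\<^sub>C op_app (op_matrix_plus A (blocks H B) i j) x"
proof -
  have lin: "linear_op (direct_sum H) (direct_sum H) B" and dom: "op_dom B = direct_sum H"
    using assms(1) by (auto simp: bounded_ops_def)
  have x: "x \<in> op_dom (A i j)" "x \<in> H j"
    using assms(2) linear_op_dom[OF operator_matrix_linear_op] by blast+
  have "axis j x \<in> op_dom B"
    using x unfolding dom
    by (auto simp: direct_sum_def axis_def csubspace_0[OF hilbert_family_csubspace])
  moreover have "axis j (c *\<^sub>C x) = c *\<^sub>C axis j x"
    by (simp add: vec_eq_iff scaleC_vec_def axis_def)
  ultimately have "op_app B (axis j (c *\<^sub>C x)) $ i = c *\<^sub>C (op_app B (axis j x) $ i)"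
    using linear_op_scaleC[OF lin, of "axis j x" c] by (simp add: scaleC_vec_def)
  then show ?thesis
    using linear_op_scaleC[OF operator_matrix_linear_op x(1)]
    by (simp add: op_matrix_plus_def op_plus_def blocks_def scaleC_add_right)
qed

text \<open>Write each component of \<open>f\<close> as its norm times a unit vector. Pairing the
  kernel equation componentwise with these unit vectors says that the compression annihilates the
  nonzero vector of norms.\<close>

lemma kernel_imp_singular_compression:
  assumes B: "B \<in> bounded_ops (direct_sum H)"
    and f: "f \<in> op_dom (matrix_op A)" "f \<noteq> 0"
    and ker: "op_app (matrix_op A) f + op_app B f = 0"
  shows "\<exists>g \<in> op_dom (matrix_op A) \<inter> unit_tuples H.
    0 \<in> matrix_spectrum (compression (op_matrix_plus A (blocks H B)) g)"
proof -
  define M where "M = op_matrix_plus A (blocks H B)"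
  obtain e where e: "\<And>j. e j \<in> (\<Inter>i. op_dom (A i j))" "\<And>j. norm (e j) = 1"
    using column_dom_unit_vector by metis
  \<comment> \<open>\<open>unit_tuples\<close> asks for norm 1 in every component, hence the
    fallback \<open>e j\<close> where \<open>f\<close> vanishes.\<close>
  define g :: "'a ^ 'n" where "g = (\<chi> j. if f $ j = 0 then e j
      else complex_of_real (1 / norm (f $ j)) *\<^sub>C (f $ j))"
  \<comment> \<open>Where \<open>f $ j\<close> is 0, the factor \<open>norm (f $ j)\<close> is 0
    too, so the fallback does not disturb the identity.\<close>
  have fg: "f $ j = complex_of_real (norm (f $ j)) *\<^sub>C (g $ j)" for j
    by (simp add: g_def scaleC_scaleC scaleC_one)
  have g_mem: "g $ j \<in> (\<Inter>i. op_dom (A i j))" for j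
  proof -
    have "f $ j \<in> (\<Inter>i. op_dom (A i j))"
      using f(1) by (simp add: matrix_op_dom direct_sum_def)
    then show ?thesis
      using e(1)[of j] csubspace_scaleC[OF csubspace_column_dom] by (simp add: g_def)
  qed
  then have g_dom: "g \<in> op_dom (matrix_op A)"
    by (simp add: matrix_op_dom direct_sum_def)
  moreover have "norm (g $ j) = 1" for j
    by (simp add: g_def norm_scaleC norm_divide e(2))
  ultimately have g: "g \<in> op_dom (matrix_op A) \<inter> unit_tuples H"
    using linear_op_dom[OF linear_op_matrix_op] by (auto simp: unit_tuples_def)
  define v :: "complex ^ 'n" where "v = (\<chi> j. complex_of_real (norm (f $ j)))"
  have "compression M g *v v = 0"
  proof -
    have "(compression M g *v v) $ i = 0" for i
    proof -
      have "(compression M g *v v) $ i = (\<Sum>j\<in>UNIV. cinner (op_app (M i j) (f $ j)) (g $ i))"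
      proof -
        \<comment> \<open>Homogeneity of the perturbed entries on the column domain pulls the norm
          of \<open>f $ j\<close> out as the scalar \<open>v $ j\<close>.\<close>
        have "op_app (M i j) (f $ j) = v $ j *\<^sub>C op_app (M i j) (g $ j)" for j
          using operator_matrix_perturbed_linear[OF B g_mem, of i j "v $ j"] fg[of j]
          by (simp add: M_def v_def)
        then show ?thesis
          by (simp add: matrix_vector_mult_def compression_def cinner_scaleC_left mult.commute)
      qed
      also have "\<dots> = cinner (op_app (matrix_op M) f $ i) (g $ i)"
        by (simp add: cinner_sum_left matrix_op_app)
      also have "\<dots> = 0"
        unfolding M_def app_perturbed[OF B f(1)] ker by simp
      finally show ?thesis .
    qed
    then show ?thesis
      by (simp add: vec_eq_iff)
  qed
  moreover have "v \<noteq> 0"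
    using f(2) by (auto simp: vec_eq_iff v_def)
  \<comment> \<open>For square matrices invertibility amounts to a left inverse, which a nonzero
    kernel vector excludes.\<close>
  ultimately have "\<not> invertible (compression M g)"
    unfolding invertible_left_inverse matrix_left_invertible_ker by blast
  \<comment> \<open>The shift in \<open>matrix_spectrum\<close> at 0 is by \<open>mat 0\<close>, the
    zero matrix.\<close>
  then have "0 \<in> matrix_spectrum (compression M g)"
    by (simp add: matrix_spectrum_def mat_def vec_eq_iff zero_vec_def[symmetric])
  then show ?thesis
    using g unfolding M_def by blast
qed

text \<open>Since \<open>f\<close> has norm 1, the Cauchy-Schwarz bound for the rank-one operator is
  the norm of the image of \<open>f\<close>, so the strict inequality carries over to
  \<open>op_norm B\<close>.\<close>

lemma small_image_imp_singular_compression: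
  assumes f: "f \<in> op_dom (matrix_op A)" "norm f = 1"
    and small: "norm (op_app (matrix_op A) f) < \<epsilon>"
  shows "\<exists>B \<in> bounded_ops (direct_sum H). op_norm B < \<epsilon> \<and>
    (\<exists>g \<in> op_dom (matrix_op A) \<inter> unit_tuples H.
      0 \<in> matrix_spectrum (compression (op_matrix_plus A (blocks H B)) g))"
proof -
  \<comment> \<open>As \<open>cinner f f\<close> is 1, the rank-one operator \<open>B\<close> sends
    \<open>f\<close> to \<open>w\<close>, the negative of its image under the matrix.\<close>
  define w where "w = (- 1) *\<^sub>C op_app (matrix_op A) f"
  define B where "B = \<lparr>op_dom = direct_sum H, op_app = (\<lambda>x. cinner x f *\<^sub>C w)\<rparr>"
  have w: "w \<in> direct_sum H" "norm w < \<epsilon>"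
    using linear_op_range[OF linear_op_matrix_op f(1)] small
    by (auto simp: w_def norm_scaleC csubspace_scaleC[OF csubspace_hilbert_direct_sum])
  note B = rank_one_bounded_op[OF csubspace_hilbert_direct_sum w(1), of f, folded B_def]
  have "op_app (matrix_op A) f + op_app B f = 0"
    using f(2) by (simp add: B_def w_def cinner_self scaleC_one scaleC_minus_left)
  moreover have "f \<noteq> 0"
    using f(2) by auto
  ultimately show ?thesis
    using kernel_imp_singular_compression[OF B(1) f(1)] B w(2) f(2) by force
qed

text \<open>The components of \<open>g\<close> have norm 1, so minus \<mu> times the identity
  compresses to \<open>- mat \<mu>\<close>. The same \<open>g\<close> thus witnesses 0 for the
  perturbed matrix and \<mu> for \<open>A\<close>.\<close>

lemma small_spectral_point_imp_singular_compression:
  assumes \<mu>: "\<mu> \<in> block_numerical_range H A" and small: "cmod \<mu> < \<epsilon>"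
  shows "\<exists>B \<in> bounded_ops (direct_sum H). op_norm B < \<epsilon> \<and>
    (\<exists>g \<in> op_dom (matrix_op A) \<inter> unit_tuples H.
      0 \<in> matrix_spectrum (compression (op_matrix_plus A (blocks H B)) g))"
proof -
  obtain g where g: "g \<in> op_dom (matrix_op A) \<inter> unit_tuples H"
    and ev: "\<not> invertible (compression A g - mat \<mu>)"
    using \<mu> by (auto simp: block_numerical_range_def matrix_spectrum_def)
  define B where "B = \<lparr>op_dom = direct_sum H, op_app = (\<lambda>x. (- \<mu>) *\<^sub>C x)\<rparr>"
  note B = scalar_bounded_op[OF csubspace_hilbert_direct_sum, of "- \<mu>", folded B_def]
  have "cinner (g $ i) (g $ i) = 1" for i
    using g by (simp add: unit_tuples_def cinner_self)
  then have "compression (op_matrix_plus A (blocks H B)) g - mat 0 = compression A g - mat \<mu>"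
    by (simp add: vec_eq_iff compression_def op_matrix_plus_def op_plus_def blocks_def B_def
        scaleC_vec_def axis_def mat_def cinner_add_left cinner_scaleC_left)
  then have "0 \<in> matrix_spectrum (compression (op_matrix_plus A (blocks H B)) g)"
    using ev by (simp add: matrix_spectrum_def)
  then show ?thesis
    using B g small by force
qed

end

section \<open>From single operator matrices to families\<close>

lemma eps_block_numerical_rangeI:
  assumes "hilbert_family H" and "operator_matrix H (L z)" and "z \<in> \<Omega>"
    and "\<exists>B \<in> bounded_ops (direct_sum H). op_norm B < \<epsilon> \<and>
      (\<exists>g \<in> op_dom (matrix_op (L z)) \<inter> unit_tuples H.
        0 \<in> matrix_spectrum (compression (op_matrix_plus (L z) (blocks H B)) g))"
  shows "z \<in> eps_block_numerical_range H \<Omega> \<epsilon> L"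
  \<comment> \<open>Membership of \<open>z\<close> involves the perturbed family only at
    \<open>z\<close>, and its domain there is that of \<open>L z\<close>; so \<open>B\<close> may
    depend on \<open>z\<close>.\<close>
  using assms(3,4) dom_perturbed[OF assms(1,2)]
  unfolding eps_block_numerical_range_def family_block_numerical_range_def by auto

theorem theorem4p10:
  fixes H :: "'n::finite \<Rightarrow> 'a::complex_hilbert_space set"
    and \<Omega> :: "complex set"
    and L :: "('a, 'n) op_matrix_family"
  assumes "hilbert_family H"
    and "open \<Omega>" and "connected \<Omega>" and "\<Omega> \<noteq> {}"
    and "\<And>z. z \<in> \<Omega> \<Longrightarrow> operator_matrix H (L z)"
  shows "(\<forall>\<epsilon>>0.
            eps_approx_point_spectrum \<Omega> \<epsilon> L \<subseteq> eps_block_numerical_range H \<Omega> \<epsilon> L \<and>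
            (\<forall>z \<in> family_resolvent_set H \<Omega> L - eps_block_numerical_range H \<Omega> \<epsilon> L.
              op_norm (op_inverse (matrix_op (L z))) \<le> 1 / \<epsilon>)) \<and>
         approx_point_spectrum \<Omega> L \<subseteq> pseudo_block_numerical_range H \<Omega> L \<and>
         ((\<forall>z \<in> \<Omega>. op_spectrum (direct_sum H) (matrix_op (L z))
                    \<subseteq> closure (block_numerical_range H (L z))) \<longrightarrow>
            family_spectrum H \<Omega> L \<subseteq> pseudo_block_numerical_range0 H \<Omega> L \<and>
            pseudo_block_numerical_range0 H \<Omega> L \<subseteq> pseudo_block_numerical_range H \<Omega> L)"
proof -
  note H = assms(1) and A = assms(5)
  have ap_eps: "eps_approx_point_spectrum \<Omega> \<epsilon> L \<subseteq> eps_block_numerical_range H \<Omega> \<epsilon> L" for \<epsilon>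
  proof
    fix z assume "z \<in> eps_approx_point_spectrum \<Omega> \<epsilon> L"
    then obtain f where z: "z \<in> \<Omega>" and f: "f \<in> op_dom (matrix_op (L z))" "norm f = 1"
      "norm (op_app (matrix_op (L z)) f) < \<epsilon>"
      by (auto simp: eps_approx_point_spectrum_def)
    show "z \<in> eps_block_numerical_range H \<Omega> \<epsilon> L"
      using small_image_imp_singular_compression[OF H A[OF z] f]
      by (rule eps_block_numerical_rangeI[where L = L, OF H A[OF z] z])
  qed
  have resolvent: "op_norm (op_inverse (matrix_op (L z))) \<le> 1 / \<epsilon>"
    if \<epsilon>: "\<epsilon> > 0" and z: "z \<in> family_resolvent_set H \<Omega> L - eps_block_numerical_range H \<Omega> \<epsilon> L"
    for \<epsilon> z
  proof -
    define T where "T = matrix_op (L z)"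
    have z\<Omega>: "z \<in> \<Omega>" and "0 \<in> op_resolvent_set (direct_sum H) T"
      using z by (auto simp: family_resolvent_set_def family_spectrum_def op_spectrum_def T_def)
    moreover have "op_shift T 0 = T"
      by (simp add: op_shift_def)
    ultimately have inj: "inj_on (op_app T) (op_dom T)"
      by (simp add: op_resolvent_set_def)
    have lin: "linear_op (direct_sum H) (direct_sum H) T"
      unfolding T_def by (rule linear_op_matrix_op[OF H A[OF z\<Omega>]])
    \<comment> \<open>By \<open>ap_eps\<close>, \<open>z\<close> also lies outside the
      \<epsilon>-approximate point spectrum. This bounds \<open>T\<close> from below on unit
      vectors, and rescaling extends the bound to the whole domain.\<close>
    have bound: "\<epsilon> * norm f \<le> norm (op_app T f)" if f: "f \<in> op_dom T" for f
    proof (cases "f = 0")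
      case False
      let ?c = "complex_of_real (1 / norm f)"
      have "?c *\<^sub>C f \<in> op_dom T" and "norm (?c *\<^sub>C f) = 1"
        using csubspace_scaleC[OF linear_op_csubspace[OF lin] f] False
        by (auto simp: norm_scaleC norm_divide)
      moreover have "z \<notin> eps_approx_point_spectrum \<Omega> \<epsilon> L"
        using ap_eps z by blast
      ultimately have "\<epsilon> \<le> norm (op_app T (?c *\<^sub>C f))"
        using z\<Omega> unfolding eps_approx_point_spectrum_def T_def by force
      also have "\<dots> = norm (op_app T f) / norm f"
        using linear_op_scaleC[OF lin f, of ?c] by (simp add: norm_scaleC norm_divide)
      finally show ?thesis
        using False by (simp add: pos_le_divide_eq)
    qed simp
    show ?thesis
      unfolding T_def[symmetric]
    proof (rule op_norm_le)
      show "0 \<in> op_dom (op_inverse T)"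
        using linear_op_0[OF lin] csubspace_0[OF linear_op_csubspace[OF lin]]
        by (force simp: op_inverse_def)
      \<comment> \<open>An element \<open>y\<close> of this domain is the image of some
        \<open>f\<close> in \<open>op_dom T\<close>; injectivity makes the inverse return this
        \<open>f\<close>, and \<open>bound\<close> applies.\<close>
      show "norm (op_app (op_inverse T) y) \<le> 1 / \<epsilon> * norm y" if "y \<in> op_dom (op_inverse T)" for y
        using that bound \<epsilon> by (auto simp: op_inverse_def inv_into_f_f[OF inj] field_simps)
    qed (use \<epsilon> in simp)
  qed
  have "approx_point_spectrum \<Omega> L \<subseteq> eps_approx_point_spectrum \<Omega> \<epsilon> L" if "\<epsilon> > 0" for \<epsilon>
  proof
    fix z assume "z \<in> approx_point_spectrum \<Omega> L"
    then obtain f where z: "z \<in> \<Omega>"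
      and f: "\<And>k::nat. f k \<in> op_dom (matrix_op (L z))" "\<And>k. norm (f k) = 1"
      and lim: "(\<lambda>k. op_app (matrix_op (L z)) (f k)) \<longlonglongrightarrow> 0"
      by (auto simp: approx_point_spectrum_def)
    \<comment> \<open>One sufficiently late member of the sequence is a witness for the given
      \<epsilon>.\<close>
    obtain k where "norm (op_app (matrix_op (L z)) (f k)) < \<epsilon>"
      using LIMSEQ_D[OF lim \<open>\<epsilon> > 0\<close>] by auto
    then show "z \<in> eps_approx_point_spectrum \<Omega> \<epsilon> L"
      using z f by (auto simp: eps_approx_point_spectrum_def)
  qed
  then have ap: "approx_point_spectrum \<Omega> L \<subseteq> pseudo_block_numerical_range H \<Omega> L"
    using ap_eps unfolding pseudo_block_numerical_range_def by fast
  have "pseudo_block_numerical_range0 H \<Omega> L \<subseteq> pseudo_block_numerical_range H \<Omega> L"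
    unfolding pseudo_block_numerical_range_def
  proof (intro subsetI INT_I)
    fix z \<epsilon> assume z: "z \<in> pseudo_block_numerical_range0 H \<Omega> L" and \<epsilon>: "\<epsilon> \<in> {0::real<..}"
    then have z\<Omega>: "z \<in> \<Omega>"
      by (simp add: pseudo_block_numerical_range0_def)
    \<comment> \<open>A point of the block numerical range within \<epsilon> of 0 exists because 0
      lies in its closure.\<close>
    obtain \<mu> where "\<mu> \<in> block_numerical_range H (L z)" "cmod \<mu> < \<epsilon>"
      using z \<epsilon> by (auto simp: pseudo_block_numerical_range0_def closure_approachable)
    then show "z \<in> eps_block_numerical_range H \<Omega> \<epsilon> L"
      using small_spectral_point_imp_singular_compression[OF H A[OF z\<Omega>]]
      by (intro eps_block_numerical_rangeI[where L = L, OF H A[OF z\<Omega>] z\<Omega>])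
  qed
  \<comment> \<open>The remaining inclusion of the spectrum is the assumed spectral inclusion read
    at the point 0.\<close>
  then show ?thesis
    using ap_eps resolvent ap
    by (auto simp: family_spectrum_def pseudo_block_numerical_range0_def)
qed

end
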